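(* Consider a path $z:[0,t_f]\to\mathbb R^2$ of type $SOS$, and let $d=\|z(0)-z(t_f)\|$ be the distance between its initial and final points. If $\dfrac{d}{t_f}>b$, where $b$ is the solution of $$\operatorname{sinc}^{-1}(b)\,(1-b)=\frac{\pi}{2},$$ then the path is not optimal, i.e. it is not a solution of Problem (P) for its own endpoints, endpoint velocities and length.
   Context: Problem (P): given $z_0,z_f\in\mathbb R^2$, unit vectors $v_0,v_f\in\mathbb R^2$, and $t_f>0$, minimize $\operatorname{ess\,max}_{t\in[0,t_f]}\|\ddot z(t)\|$ over curves $z\in W^{2,\infty}((0,t_f),\mathbb R^2)$ with $z(0)=z_0$, $z(t_f)=z_f$, $\dot z(0)=v_0$, $\dot z(t_f)=v_f$ and $\|\dot z(t)\|=1$ for a.e. $t$. A path of type $SOS$ is a unit-speed $C^1$ path consisting of a straight line segment, followed by a full circle of some radius $R>0$ covered exactly once (tangent to the line), followed by a straight line segment; thus the two segments lie along the same line, in the same direction, and $t_f=d+2\pi R$. $\operatorname{sinc}(s)=\sin(s)/s$ for $s\ne0$, $\operatorname{sinc}(0)=1$, and $\operatorname{sinc}^{-1}:[0,1]\to[0,\pi]$ is the inverse of the restriction of $\operatorname{sinc}$ to $[0,\pi]$. The equation defining $b$ is considered on $[0,1)$, where its left-hand side is decreasing; $b\approx0.31997$. *)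

theory Defs
  imports "HOL-Probability.Probability"
begin

type_synonym curve = "real \<Rightarrow> real ^ 2"

definition L_inf :: "real \<Rightarrow> curve \<Rightarrow> bool" where
  "L_inf T f \<longleftrightarrow>
     f \<in> borel_measurable (lebesgue_on {0<..<T}) \<and>
     esssup (lebesgue_on {0<..<T}) (\<lambda>t. ereal (norm (f t))) < \<infinity>"

definition test_fun :: "real \<Rightarrow> (real \<Rightarrow> real) \<Rightarrow> (real \<Rightarrow> real) \<Rightarrow> bool" where
  "test_fun T \<phi> \<phi>' \<longleftrightarrow>
     (\<forall>t. (\<phi> has_real_derivative \<phi>' t) (at t)) \<and> continuous_on UNIV \<phi>' \<and>
     (\<exists>\<alpha> \<beta>. 0 < \<alpha> \<and> \<beta> < T \<and> (\<forall>t. t \<notin> {\<alpha>..\<beta>} \<longrightarrow> \<phi> t = 0))"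

(* C^1 test functions with compact support in (0,T); for weak derivatives on an
   interval they give the same notion as smooth ones. *)
definition has_weak_deriv :: "real \<Rightarrow> curve \<Rightarrow> curve \<Rightarrow> bool" where
  "has_weak_deriv T f g \<longleftrightarrow>
     (\<forall>\<phi> \<phi>'. test_fun T \<phi> \<phi>' \<longrightarrow>
        (LINT t|lebesgue_on {0<..<T}. \<phi>' t *\<^sub>R f t) =
        - (LINT t|lebesgue_on {0<..<T}. \<phi> t *\<^sub>R g t))"

definition has_weak_deriv2 :: "real \<Rightarrow> curve \<Rightarrow> curve \<Rightarrow> bool" where
  "has_weak_deriv2 T z a \<longleftrightarrow>
     (\<exists>v. L_inf T z \<and> L_inf T v \<and> L_inf T a \<and>
          has_weak_deriv T z v \<and> has_weak_deriv T v a)"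

definition W2_inf :: "real \<Rightarrow> curve \<Rightarrow> bool" where
  "W2_inf T z \<longleftrightarrow> (\<exists>a. has_weak_deriv2 T z a)"

(* The second weak derivative is unique up to a null set, so the infimum is
   over equal values; it only serves to avoid choosing a representative. *)
definition max_accel :: "real \<Rightarrow> curve \<Rightarrow> ereal" where
  "max_accel T z =
     (INF a \<in> {a. has_weak_deriv2 T z a}.
        esssup (lebesgue_on {0<..<T}) (\<lambda>t. ereal (norm (a t))))"

definition velocity :: "real \<Rightarrow> curve \<Rightarrow> curve" where
  "velocity T z t = vector_derivative z (at t within {0..T})"

definition C1_curve :: "real \<Rightarrow> curve \<Rightarrow> bool" where
  "C1_curve T z \<longleftrightarrow>
     (\<forall>t\<in>{0..T}. (z has_vector_derivative velocity T z t) (at t within {0..T})) \<and>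
     continuous_on {0..T} (velocity T z)"

(* Every class in W^{2,\<infinity>} of (0,T) has exactly one representative that is C^1 on
   [0,T]. Requiring z to be that representative is what gives a meaning to the
   boundary conditions. *)
definition admissible ::
  "real \<Rightarrow> real ^ 2 \<Rightarrow> real ^ 2 \<Rightarrow> real ^ 2 \<Rightarrow> real ^ 2 \<Rightarrow> curve \<Rightarrow> bool" where
  "admissible T z0 zf v0 vf z \<longleftrightarrow>
     W2_inf T z \<and> C1_curve T z \<and>
     z 0 = z0 \<and> z T = zf \<and> velocity T z 0 = v0 \<and> velocity T z T = vf \<and>
     (AE t in lebesgue_on {0<..<T}. norm (velocity T z t) = 1)"

definition solution_P ::
  "real \<Rightarrow> real ^ 2 \<Rightarrow> real ^ 2 \<Rightarrow> real ^ 2 \<Rightarrow> real ^ 2 \<Rightarrow> curve \<Rightarrow> bool" where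
  "solution_P T z0 zf v0 vf z \<longleftrightarrow>
     admissible T z0 zf v0 vf z \<and>
     (\<forall>y. admissible T z0 zf v0 vf y \<longrightarrow> max_accel T z \<le> max_accel T y)"

(* The circle is run through at unit speed on [t1,t2], in either orientation
   (\<sigma> = 1 or -1). Tangency to the two segments is forced by C1_curve. *)
definition SOS_path :: "real \<Rightarrow> curve \<Rightarrow> bool" where
  "SOS_path T z \<longleftrightarrow>
     C1_curve T z \<and> (\<forall>t\<in>{0..T}. norm (velocity T z t) = 1) \<and>
     (\<exists>R t1 t2 c \<theta> \<sigma> u w.
        R > 0 \<and> 0 \<le> t1 \<and> t2 = t1 + 2 * pi * R \<and> t2 \<le> T \<and> \<sigma> \<in> {1, -1} \<and>
        (\<forall>t\<in>{0..t1}. z t = z 0 + t *\<^sub>R u) \<and>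
        (\<forall>t\<in>{t1..t2}. z t = c + R *\<^sub>R vector [cos (\<theta> + \<sigma> * (t - t1) / R),
                                               sin (\<theta> + \<sigma> * (t - t1) / R)]) \<and>
        (\<forall>t\<in>{t2..T}. z t = z t2 + (t - t2) *\<^sub>R w))"

definition sinc_inv :: "real \<Rightarrow> real" where
  "sinc_inv = the_inv_into {0..pi} sinc"

end

theory Submission
  imports Defs
begin

text \<open>
  An SOS path with a circle of radius \<open>R\<close> has acceleration \<open>1 / R\<close> on the circle, and
  \<open>2 \<pi> R = T - d\<close>, so with \<open>r = d / T\<close> its cost is at least \<open>2 \<pi> / (T (1 - r))\<close>. The loop only
  serves to waste the surplus length \<open>T - d\<close>. The same length can be wasted without a full turn, by
  a wavy curve whose heading, measured from the common direction of the two segments, zigzags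
  linearly \<open>0 \<rightarrow> A \<rightarrow> -A \<rightarrow> 0\<close>: the lateral displacements cancel by symmetry, and the
  longitudinal displacement is \<open>T\<close> times the mean of the cosine over \<open>[0, A]\<close>, that is
  \<open>T sinc A\<close>. For \<open>A = sinc_inv r\<close> the endpoints therefore agree with those of the SOS path, and the
  heading sweeps a total angle \<open>4 A\<close> in time \<open>T\<close>, which costs the acceleration \<open>4 A / T\<close>.
  The wavy curve is better as soon as \<open>A (1 - r) < \<pi> / 2\<close>. Since both factors of
  \<open>sinc_inv r * (1 - r)\<close> decrease with \<open>r\<close>, and the product is \<open>\<pi> / 2\<close> at \<open>r = b\<close>, this is the
  case for every \<open>r > b\<close> (\<open>zigzag_competitor\<close>).

  The cost is an essential supremum of a weak second derivative, so the bound \<open>1 / R\<close> from below has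
  to hold for every weak second derivative of the SOS path. Instead of proving uniqueness of weak
  derivatives, \<open>max_accel_circular_arc\<close> tests the derivative with a nonnegative bump times the outward
  unit normal of the circle, with the bump supported inside the time interval of the circle.
\<close>

section \<open>The cardinal sine on its decreasing branch\<close>

text \<open>
  The sign of the derivative is that of \<open>w cos w - sin w\<close>, which is negative on \<open>(0, \<pi>)\<close>
  because \<open>sin w - w cos w\<close> vanishes at \<open>0\<close> and has the derivative \<open>w sin w > 0\<close>.
\<close>

lemma sinc_strict_decreasing:
  assumes "0 \<le> x" "x < y" "y \<le> pi"
  shows "sinc y < sinc x"
proof (rule DERIV_neg_imp_decreasing_open[OF assms(2)])
  fix w assume w: "x < w" "w < y"
  with assms have w': "0 < w" "w < pi" by auto
  have "(\<lambda>s. sin s - s * cos s) 0 < (\<lambda>s. sin s - s * cos s) w"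
  proof (rule DERIV_pos_imp_increasing_open[OF w'(1)])
    fix s assume s: "0 < s" "s < w"
    have "((\<lambda>s. sin s - s * cos s) has_real_derivative s * sin s) (at s)"
      by (auto intro!: derivative_eq_intros simp: algebra_simps)
    moreover have "s * sin s > 0"
      using s w' by (intro mult_pos_pos sin_gt_zero) auto
    ultimately show "\<exists>D. ((\<lambda>s. sin s - s * cos s) has_real_derivative D) (at s) \<and> 0 < D"
      by blast
  qed (intro continuous_intros)
  then have neg: "cos w * w - sin w < 0" by (simp add: mult.commute)
  have "((\<lambda>s. sin s / s) has_real_derivative (cos w * w - sin w) / w\<^sup>2) (at w)"
    using w' by (auto intro!: derivative_eq_intros simp: power2_eq_square)
  then have "(sinc has_real_derivative (cos w * w - sin w) / w\<^sup>2) (at w)"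
    by (rule has_field_derivative_transform_within_open[where S = "{0<..}"]) (use w' in auto)
  moreover have "(cos w * w - sin w) / w\<^sup>2 < 0"
    using neg w' by (simp add: divide_neg_pos)
  ultimately show "\<exists>D. (sinc has_real_derivative D) (at w) \<and> D < 0" by blast
qed (intro continuous_on_sinc continuous_on_id)

lemma sinc_inv_properties:
  assumes "0 \<le> x" "x \<le> 1"
  shows "sinc_inv x \<in> {0..pi}" "sinc (sinc_inv x) = x"
proof -
  have inj: "inj_on sinc {0..pi}"
  proof (rule linorder_inj_onI)
    fix s t :: real assume "s < t" "s \<in> {0..pi}" "t \<in> {0..pi}"
    then have "sinc t < sinc s" by (intro sinc_strict_decreasing) auto
    then show "sinc s \<noteq> sinc t" by simp
  qed auto
  have "\<exists>s. 0 \<le> s \<and> s \<le> pi \<and> sinc s = x"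
    by (rule IVT2') (use assms in \<open>auto intro!: continuous_on_sinc continuous_on_id\<close>)
  then have mem: "x \<in> sinc ` {0..pi}" by force
  show "sinc_inv x \<in> {0..pi}"
    unfolding sinc_inv_def by (rule the_inv_into_into[OF inj mem]) simp
  show "sinc (sinc_inv x) = x"
    unfolding sinc_inv_def by (rule f_the_inv_into_f[OF inj mem])
qed

lemma sinc_inv_strict_decreasing:
  assumes "0 \<le> x" "x < y" "y \<le> 1"
  shows "sinc_inv y < sinc_inv x"
proof (rule ccontr)
  assume "\<not> sinc_inv y < sinc_inv x"
  then consider "sinc_inv x = sinc_inv y" | "sinc_inv x < sinc_inv y" by linarith
  then have "sinc (sinc_inv y) \<le> sinc (sinc_inv x)"
  proof cases
    case 2
    have "0 \<le> sinc_inv x" "sinc_inv y \<le> pi"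
      using sinc_inv_properties(1)[of x] sinc_inv_properties(1)[of y] assms by auto
    from sinc_strict_decreasing[OF this(1) 2 this(2)] show ?thesis by (rule less_imp_le)
  qed simp
  moreover have "sinc (sinc_inv x) = x" "sinc (sinc_inv y) = y"
    by (rule sinc_inv_properties(2); use assms in linarith)+
  ultimately show False
    using assms by simp
qed

section \<open>Weak derivatives on an interval\<close>

lemma test_fun_continuous: "test_fun T \<phi> \<phi>' \<Longrightarrow> continuous_on S \<phi>"
  unfolding test_fun_def by (meson DERIV_isCont continuous_at_imp_continuous_on)

lemma L_inf_AE_bounded:
  assumes "L_inf T a"
  obtains B where "B \<ge> 0" "AE t in lebesgue_on {0<..<T}. norm (a t) \<le> B"
proof -
  let ?M = "esssup (lebesgue_on {0<..<T}) (\<lambda>t. ereal (norm (a t)))"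
  obtain B where B: "?M < ereal B"
    using assms ereal_dense2[of ?M \<infinity>] by (auto simp: L_inf_def)
  have "AE t in lebesgue_on {0<..<T}. norm (a t) \<le> max B 0"
    using esssup_AE[of "\<lambda>t. ereal (norm (a t))" "lebesgue_on {0<..<T}"]
  proof eventually_elim
    case (elim t)
    then have "ereal (norm (a t)) < ereal B" using B by (rule le_less_trans)
    then show ?case by simp
  qed
  then show ?thesis using that[of "max B 0"] by simp
qed

lemma L_infI:
  assumes "a \<in> borel_measurable (lebesgue_on {0<..<T})"
    and "\<And>t. t \<in> {0<..<T} \<Longrightarrow> norm (a t) \<le> B"
  shows "L_inf T a" "esssup (lebesgue_on {0<..<T}) (\<lambda>t. ereal (norm (a t))) \<le> ereal B"
proof -
  show *: "esssup (lebesgue_on {0<..<T}) (\<lambda>t. ereal (norm (a t))) \<le> ereal B"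
    by (rule esssup_I) (use assms in auto)
  show "L_inf T a"
    unfolding L_inf_def using assms(1) le_less_trans[OF *, of "\<infinity>"] by auto
qed

lemma continuous_imp_L_inf:
  assumes "continuous_on {0..T} a"
  shows "L_inf T a"
proof -
  have "bounded (a ` {0..T})"
    by (intro compact_imp_bounded compact_continuous_image assms compact_Icc)
  then obtain B where "\<forall>t\<in>{0..T}. norm (a t) \<le> B"
    by (auto simp: bounded_iff)
  moreover have "a \<in> borel_measurable (lebesgue_on {0<..<T})"
    by (intro continuous_imp_measurable_on_sets_lebesgue continuous_on_subset[OF assms]) auto
  ultimately show ?thesis by (intro L_infI(1)[of a T B]) auto
qed

lemma integrable_continuous_scaleR_L_inf:
  assumes "continuous_on {0..T} \<phi>" "L_inf T a"
  shows "integrable (lebesgue_on {0<..<T}) (\<lambda>t. \<phi> t *\<^sub>R a t)"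
proof -
  have "bounded (\<phi> ` {0..T})"
    by (intro compact_imp_bounded compact_continuous_image assms compact_Icc)
  then obtain C where C: "\<forall>t\<in>{0..T}. norm (\<phi> t) \<le> C"
    by (auto simp: bounded_iff)
  obtain B where B: "B \<ge> 0" "AE t in lebesgue_on {0<..<T}. norm (a t) \<le> B"
    using L_inf_AE_bounded[OF assms(2)] .
  have "\<phi> \<in> borel_measurable (lebesgue_on {0<..<T})"
    by (intro continuous_imp_measurable_on_sets_lebesgue continuous_on_subset[OF assms(1)]) auto
  moreover have "a \<in> borel_measurable (lebesgue_on {0<..<T})"
    using assms(2) by (simp add: L_inf_def)
  ultimately have meas: "(\<lambda>t. \<phi> t *\<^sub>R a t) \<in> borel_measurable (lebesgue_on {0<..<T})"
    by measurable
  have bound: "AE t in lebesgue_on {0<..<T}. norm (\<phi> t *\<^sub>R a t) \<le> C * B"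
    using B(2) AE_space
  proof eventually_elim
    case (elim t)
    then have "norm (\<phi> t) \<le> C" using C by auto
    then show ?case
      using elim(1) mult_mono'[of "norm (\<phi> t)" C "norm (a t)" B] by simp
  qed
  have "{0<..<T} \<in> lmeasurable"
    using lmeasurable_box[of 0 T] by (simp only: box_real)
  then have "finite_measure (lebesgue_on {0<..<T})"
    by (rule finite_measure_lebesgue_on)
  then show ?thesis
    using bound meas by (rule finite_measure.integrable_const_bound)
qed

text \<open>
  Finitely many corners of a continuous function do not show up in its weak derivative, because the
  fundamental theorem of calculus for \<open>\<phi> f\<close> tolerates finitely many exceptional points; the
  boundary terms vanish with \<open>\<phi>\<close>. A zigzag heading produces a velocity with two corners.
\<close>

lemma weak_deriv_if_piecewise_deriv:
  assumes S: "finite S" and T: "0 \<le> T" and f: "continuous_on {0..T} f"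
    and deriv: "\<And>t. t \<in> {0<..<T} - S \<Longrightarrow> (f has_vector_derivative g t) (at t)"
    and g: "L_inf T g"
  shows "has_weak_deriv T f g"
  unfolding has_weak_deriv_def
proof (intro allI impI)
  fix \<phi> \<phi>' assume test: "test_fun T \<phi> \<phi>'"
  have \<phi>_cont: "continuous_on {0..T} \<phi>" by (rule test_fun_continuous[OF test])
  have \<phi>': "\<And>t. (\<phi> has_real_derivative \<phi>' t) (at t)" "continuous_on {0..T} \<phi>'"
    using test continuous_on_subset unfolding test_fun_def by auto
  have zero: "\<phi> 0 = 0" "\<phi> T = 0"
    using test unfolding test_fun_def by auto
  have int1: "integrable (lebesgue_on {0<..<T}) (\<lambda>t. \<phi>' t *\<^sub>R f t)"
    by (intro integrable_continuous_scaleR_L_inf \<phi>' continuous_imp_L_inf f)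
  have int2: "integrable (lebesgue_on {0<..<T}) (\<lambda>t. \<phi> t *\<^sub>R g t)"
    by (intro integrable_continuous_scaleR_L_inf \<phi>_cont g)
  have "((\<lambda>t. \<phi>' t *\<^sub>R f t + \<phi> t *\<^sub>R g t) has_integral (\<phi> T *\<^sub>R f T - \<phi> 0 *\<^sub>R f 0)) {0..T}"
  proof (rule fundamental_theorem_of_calculus_interior_strong[OF S T])
    fix t assume "t \<in> {0<..<T} - S"
    then show "((\<lambda>t. \<phi> t *\<^sub>R f t) has_vector_derivative \<phi>' t *\<^sub>R f t + \<phi> t *\<^sub>R g t) (at t)"
      using has_vector_derivative_scaleR[OF \<phi>'(1) deriv] by (simp add: add.commute)
  qed (intro continuous_intros \<phi>_cont f)
  then have "integral {0<..<T} (\<lambda>t. \<phi>' t *\<^sub>R f t + \<phi> t *\<^sub>R g t) = 0"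
    unfolding zero by (simp add: has_integral_Icc_iff_Ioo integral_unique)
  then have "(LINT t|lebesgue_on {0<..<T}. \<phi>' t *\<^sub>R f t + \<phi> t *\<^sub>R g t) = 0"
    using int1 int2 by (subst lebesgue_integral_eq_integral) auto
  then show "(LINT t|lebesgue_on {0<..<T}. \<phi>' t *\<^sub>R f t) =
      - (LINT t|lebesgue_on {0<..<T}. \<phi> t *\<^sub>R g t)"
    using int1 int2 by (simp add: eq_neg_iff_add_eq_0)
qed

lemma weak_deriv2_if_piecewise_deriv:
  assumes "finite S" "0 \<le> T"
    and f: "\<And>t. t \<in> {0..T} \<Longrightarrow> (f has_vector_derivative v t) (at t within {0..T})"
    and v: "continuous_on {0..T} v"
    and a: "\<And>t. t \<in> {0<..<T} - S \<Longrightarrow> (v has_vector_derivative a t) (at t)" "L_inf T a"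
  shows "has_weak_deriv2 T f a"
  unfolding has_weak_deriv2_def
proof (intro exI conjI)
  have f_cont: "continuous_on {0..T} f"
    using f by (rule continuous_on_vector_derivative)
  have "(f has_vector_derivative v t) (at t)" if "t \<in> {0<..<T} - {}" for t
    using f[of t] at_within_Icc_at[of 0 t T] that by auto
  then show "has_weak_deriv T f v"
    by (rule weak_deriv_if_piecewise_deriv[OF finite.emptyI assms(2) f_cont])
      (auto intro: continuous_imp_L_inf v)
  show "has_weak_deriv T v a"
    by (rule weak_deriv_if_piecewise_deriv[OF assms(1,2) v a])
  show "L_inf T f" "L_inf T v" "L_inf T a"
    using f_cont v a(2) by (auto intro: continuous_imp_L_inf)
qed

text \<open>
  One more derivative than in \<open>test_fun\<close>, so that both \<open>\<phi>\<close> and \<open>\<phi>'\<close> are test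
  functions and the two weak derivatives behind a weak second derivative can be moved to \<open>\<phi>\<close>
  one after the other.
\<close>

definition C2_test_fun ::
  "real \<Rightarrow> real \<Rightarrow> (real \<Rightarrow> real) \<Rightarrow> (real \<Rightarrow> real) \<Rightarrow> (real \<Rightarrow> real) \<Rightarrow> bool" where
  "C2_test_fun \<alpha> \<beta> \<phi> \<phi>' \<phi>'' \<longleftrightarrow>
     (\<forall>t. (\<phi> has_real_derivative \<phi>' t) (at t)) \<and>
     (\<forall>t. (\<phi>' has_real_derivative \<phi>'' t) (at t)) \<and> continuous_on UNIV \<phi>'' \<and>
     (\<forall>t. t \<notin> {\<alpha>..\<beta>} \<longrightarrow> \<phi> t = 0)"

lemma deriv_zero_off_support:
  fixes \<phi> \<phi>' :: "real \<Rightarrow> real"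
  assumes "\<And>t. (\<phi> has_real_derivative \<phi>' t) (at t)"
    and "\<And>t. t \<notin> {\<alpha>..\<beta>} \<Longrightarrow> \<phi> t = 0" and "t \<notin> {\<alpha>..\<beta>}"
  shows "\<phi>' t = 0"
proof -
  have "((\<lambda>_. 0) has_real_derivative \<phi>' t) (at t)"
    by (rule has_field_derivative_transform_within_open[OF assms(1), of "- {\<alpha>..\<beta>}"])
      (use assms(2,3) in \<open>auto intro: open_Compl\<close>)
  then show ?thesis
    using DERIV_unique DERIV_const by blast
qed

lemma C2_test_fun_D:
  assumes "C2_test_fun \<alpha> \<beta> \<phi> \<phi>' \<phi>''" "0 < \<alpha>" "\<beta> < T"
  shows "test_fun T \<phi> \<phi>'" "test_fun T \<phi>' \<phi>''" "t \<notin> {\<alpha>..\<beta>} \<Longrightarrow> \<phi> t = 0 \<and> \<phi>'' t = 0"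
proof -
  have \<phi>: "\<And>t. (\<phi> has_real_derivative \<phi>' t) (at t)" "\<And>t. (\<phi>' has_real_derivative \<phi>'' t) (at t)"
    "continuous_on UNIV \<phi>''" "\<And>t. t \<notin> {\<alpha>..\<beta>} \<Longrightarrow> \<phi> t = 0"
    using assms(1) unfolding C2_test_fun_def by auto
  have 1: "t \<notin> {\<alpha>..\<beta>} \<Longrightarrow> \<phi>' t = 0" for t
    using deriv_zero_off_support[OF \<phi>(1,4)] .
  have 2: "t \<notin> {\<alpha>..\<beta>} \<Longrightarrow> \<phi>'' t = 0" for t
    using deriv_zero_off_support[OF \<phi>(2) 1] .
  have "continuous_on UNIV \<phi>'"
    using \<phi>(2) by (meson DERIV_isCont continuous_at_imp_continuous_on)
  then show "test_fun T \<phi> \<phi>'" "test_fun T \<phi>' \<phi>''"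
    unfolding test_fun_def using \<phi> 1 assms(2,3) by blast+
  show "t \<notin> {\<alpha>..\<beta>} \<Longrightarrow> \<phi> t = 0 \<and> \<phi>'' t = 0"
    using 2 \<phi>(4) by blast
qed

text \<open>
  Both sides equal the integral of \<open>\<phi>''\<close> against the undifferentiated curve, and \<open>\<phi>''\<close> sees
  that curve only on the support of \<open>\<phi>\<close>. Thus an arbitrary weak second derivative \<open>a\<close> can be
  compared on the circle with the classical second derivative \<open>g\<close> of the full circular motion \<open>h\<close>.
\<close>

lemma weak_deriv2_eq_if_locally_eq:
  assumes z: "has_weak_deriv2 T z a" and h: "has_weak_deriv2 T h g"
    and eq: "\<And>t. t \<in> {\<alpha>..\<beta>} \<Longrightarrow> z t = h t"
    and \<phi>: "C2_test_fun \<alpha> \<beta> \<phi> \<phi>' \<phi>''" and \<alpha>\<beta>: "0 < \<alpha>" "\<beta> < T"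
  shows "(LINT t|lebesgue_on {0<..<T}. \<phi> t *\<^sub>R a t) = (LINT t|lebesgue_on {0<..<T}. \<phi> t *\<^sub>R g t)"
proof -
  note test = C2_test_fun_D[OF \<phi> \<alpha>\<beta>]
  have twice: "(LINT t|lebesgue_on {0<..<T}. \<phi>'' t *\<^sub>R y t) =
      (LINT t|lebesgue_on {0<..<T}. \<phi> t *\<^sub>R b t)" if y: "has_weak_deriv2 T y b" for y b
  proof -
    obtain v where v: "has_weak_deriv T y v" "has_weak_deriv T v b"
      using y unfolding has_weak_deriv2_def by blast
    have "(LINT t|lebesgue_on {0<..<T}. \<phi>'' t *\<^sub>R y t) = - (LINT t|lebesgue_on {0<..<T}. \<phi>' t *\<^sub>R v t)"
      using v(1) test(2) unfolding has_weak_deriv_def by blast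
    also have "(LINT t|lebesgue_on {0<..<T}. \<phi>' t *\<^sub>R v t) = - (LINT t|lebesgue_on {0<..<T}. \<phi> t *\<^sub>R b t)"
      using v(2) test(1) unfolding has_weak_deriv_def by blast
    finally show ?thesis by simp
  qed
  have "(\<lambda>t. \<phi>'' t *\<^sub>R z t) = (\<lambda>t. \<phi>'' t *\<^sub>R h t)"
  proof
    fix t show "\<phi>'' t *\<^sub>R z t = \<phi>'' t *\<^sub>R h t"
      using eq[of t] test(3)[of t] by (cases "t \<in> {\<alpha>..\<beta>}") auto
  qed
  then show ?thesis
    using twice[OF z] twice[OF h] by simp
qed

section \<open>A twice differentiable bump\<close>

text \<open>
  The positive part of \<open>x\<close> itself has a corner at \<open>0\<close>; each further power gains one derivative
  there, so the cube is twice continuously differentiable.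
\<close>

lemma has_derivative_pos_part_power:
  "((\<lambda>x::real. max 0 x ^ Suc (Suc n)) has_real_derivative real (Suc (Suc n)) * max 0 x ^ Suc n) (at x)"
proof (cases x "0 :: real" rule: linorder_cases)
  case less
  have "((\<lambda>_. 0) has_real_derivative real (Suc (Suc n)) * max 0 x ^ Suc n) (at x)"
    using less by simp
  then show ?thesis
    by (rule has_field_derivative_transform_within_open[of _ _ _ "{..<0}"]) (use less in auto)
next
  case equal
  have "(\<lambda>h::real. max 0 h ^ Suc n) \<midarrow>0\<rightarrow> max 0 0 ^ Suc n"
    by (intro tendsto_intros)
  then have "(\<lambda>h::real. max 0 h ^ Suc n) \<midarrow>0\<rightarrow> 0" by simp
  moreover have "\<forall>\<^sub>F h in at (0::real). max 0 h ^ Suc n = max 0 h ^ Suc (Suc n) / h"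
    by (rule eventually_at_filter[THEN iffD2], rule always_eventually) (auto simp: max_def)
  ultimately have "(\<lambda>h::real. max 0 h ^ Suc (Suc n) / h) \<midarrow>0\<rightarrow> 0"
    by (rule Lim_transform_eventually)
  then show ?thesis
    using equal by (simp add: DERIV_def)
next
  case greater
  have "((\<lambda>x. x ^ Suc (Suc n)) has_real_derivative real (Suc (Suc n)) * max 0 x ^ Suc n) (at x)"
    using greater DERIV_pow[of "Suc (Suc n)" x] by simp
  then show ?thesis
    by (rule has_field_derivative_transform_within_open[of _ _ _ "{0<..}"]) (use greater in auto)
qed

lemma C2_bump:
  assumes "\<alpha> < \<beta>"
  obtains \<psi> \<psi>' \<psi>'' where "C2_test_fun \<alpha> \<beta> \<psi> \<psi>' \<psi>''" "\<And>t. 0 \<le> \<psi> t"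
    "\<And>t. t \<in> {\<alpha><..<\<beta>} \<Longrightarrow> 0 < \<psi> t"
proof
  \<comment> \<open>\<open>q\<close> is positive exactly on \<open>(\<alpha>, \<beta>)\<close>, and the bump is the cube of its positive part.\<close>
  define q where "q t = (t - \<alpha>) * (\<beta> - t)" for t
  define q' where "q' t = \<alpha> + \<beta> - 2 * t" for t
  have q: "(q has_real_derivative q' t) (at t)" "(q' has_real_derivative -2) (at t)" for t
    unfolding q_def q'_def by (auto intro!: derivative_eq_intros)
  have P3: "((\<lambda>t. max 0 (q t) ^ 3) has_real_derivative 3 * max 0 (q t) ^ 2 * q' t) (at t)" for t
    using DERIV_chain2[OF has_derivative_pos_part_power[of 1] q(1)] by (simp add: numeral_eq_Suc)
  have P2: "((\<lambda>t. max 0 (q t) ^ 2) has_real_derivative 2 * max 0 (q t) * q' t) (at t)" for t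
    using DERIV_chain2[OF has_derivative_pos_part_power[of 0] q(1)] by (simp add: numeral_eq_Suc)
  have "((\<lambda>t. 3 * max 0 (q t) ^ 2 * q' t) has_real_derivative
      3 * (2 * max 0 (q t) * q' t) * q' t - 6 * max 0 (q t) ^ 2) (at t)" for t
    by (rule derivative_eq_intros P2 q refl | simp)+
  moreover have "continuous_on UNIV (\<lambda>t. 3 * (2 * max 0 (q t) * q' t) * q' t - 6 * max 0 (q t) ^ 2)"
    unfolding q_def q'_def by (intro continuous_intros)
  moreover have "max 0 (q t) ^ 3 = 0" if "t \<notin> {\<alpha>..\<beta>}" for t
  proof -
    have "q t \<le> 0"
      using that assms unfolding q_def by (auto simp: mult_le_0_iff not_le)
    then show ?thesis by simp
  qed
  ultimately show "C2_test_fun \<alpha> \<beta> (\<lambda>t. max 0 (q t) ^ 3) (\<lambda>t. 3 * max 0 (q t) ^ 2 * q' t)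
      (\<lambda>t. 3 * (2 * max 0 (q t) * q' t) * q' t - 6 * max 0 (q t) ^ 2)"
    unfolding C2_test_fun_def using P3 by blast
  show "0 \<le> max 0 (q t) ^ 3" for t by simp
  show "0 < max 0 (q t) ^ 3" if "t \<in> {\<alpha><..<\<beta>}" for t
    using that unfolding q_def by (auto simp: less_max_iff_disj)
qed

section \<open>Acceleration on a circular arc\<close>

text \<open>
  A linear combination of fixed vectors, so that the rules for sums and scalar multiples apply to it;
  differentiation turns the direction by a right angle.
\<close>

definition direction :: "real \<Rightarrow> real ^ 2" where
  "direction x = cos x *\<^sub>R axis 1 1 + sin x *\<^sub>R axis 2 1"

lemma direction_nth: "direction x $ 1 = cos x" "direction x $ 2 = sin x"
  by (simp_all add: direction_def axis_def)

lemma vector_cos_sin_eq_direction: "vector [cos x, sin x] = direction x"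
  by (simp add: vec_eq_iff forall_2 direction_nth)

lemma norm_direction [simp]: "norm (direction x) = 1"
  by (simp add: norm_eq_sqrt_inner inner_vec_def sum_2 direction_nth flip: power2_eq_square)

lemma direction_add_pi: "direction (x + pi) = - direction x"
  by (simp add: direction_def)

lemma unit_vector_eq_direction:
  assumes "norm (p :: real ^ 2) = 1"
  obtains x where "p = direction x"
proof -
  have "(p $ 1)\<^sup>2 + (p $ 2)\<^sup>2 = 1"
    using assms by (simp add: norm_eq_sqrt_inner inner_vec_def sum_2 flip: power2_eq_square)
  then obtain x where "p $ 1 = cos x" "p $ 2 = sin x"
    by (rule sincos_total_2pi)
  then have "p = direction x"
    by (simp add: vec_eq_iff forall_2 direction_nth)
  then show ?thesis by (rule that)
qed

lemma direction_has_vector_derivative: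
  assumes "(\<theta> has_real_derivative \<omega>) (at t within A)"
  shows "((\<lambda>t. direction (\<theta> t)) has_vector_derivative \<omega> *\<^sub>R direction (\<theta> t + pi / 2)) (at t within A)"
proof -
  have "((\<lambda>t. direction (\<theta> t)) has_vector_derivative
      (- sin (\<theta> t) * \<omega>) *\<^sub>R axis 1 1 + (cos (\<theta> t) * \<omega>) *\<^sub>R axis 2 1) (at t within A)"
    unfolding direction_def
    by (intro has_vector_derivative_add has_vector_derivative_scaleR[OF _ has_vector_derivative_const, simplified])
      (auto intro!: derivative_eq_intros assms)
  moreover have "(- sin (\<theta> t) * \<omega>) *\<^sub>R axis 1 1 + (cos (\<theta> t) * \<omega>) *\<^sub>R axis 2 1 = \<omega> *\<^sub>R direction (\<theta> t + pi / 2)"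
    by (simp add: direction_def sin_add cos_add algebra_simps)
  ultimately show ?thesis by metis
qed

lemma continuous_on_direction [continuous_intros]:
  fixes \<theta> :: "real \<Rightarrow> real"
  shows "continuous_on A \<theta> \<Longrightarrow> continuous_on A (\<lambda>t. direction (\<theta> t))"
  unfolding direction_def by (intro continuous_on_add continuous_on_scaleR continuous_on_const
      continuous_on_cos continuous_on_sin)

text \<open>
  Let \<open>e\<close> be the outward unit normal of the circle and \<open>\<psi> \<ge> 0\<close> a bump inside \<open>(t1, t2)\<close>. The
  components of \<open>\<psi> e\<close> are admissible tests, and for the circular motion \<open>e \<bullet> z'' = -1 / R\<close>.
  Hence every weak second derivative \<open>a\<close> satisfies \<open>\<integral> \<psi> / R = - \<integral> \<psi> (e \<bullet> a) \<le> m \<integral> \<psi>\<close>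
  whenever \<open>m\<close> bounds the norm of \<open>a\<close> almost everywhere, and \<open>\<integral> \<psi>\<close> can be cancelled.
\<close>

lemma max_accel_circular_arc:
  assumes t: "0 \<le> t1" "t1 < t2" "t2 \<le> T" and R: "R > 0" and \<sigma>: "\<sigma> \<in> {1, -1}"
    and arc: "\<And>t. t \<in> {t1..t2} \<Longrightarrow> z t = c + R *\<^sub>R direction (\<theta> + \<sigma> * (t - t1) / R)"
  shows "ereal (1 / R) \<le> max_accel T z"
  unfolding max_accel_def
proof (rule INF_greatest, rule ccontr)
  fix a assume "a \<in> {a. has_weak_deriv2 T z a}"
  then have a: "has_weak_deriv2 T z a" by simp
  let ?L = "lebesgue_on {0<..<T}"
  assume "\<not> ereal (1 / R) \<le> esssup ?L (\<lambda>t. ereal (norm (a t)))"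
  then obtain m where m: "esssup ?L (\<lambda>t. ereal (norm (a t))) < ereal m" "m < 1 / R"
    by (auto simp: not_le dest: ereal_dense2)
  define u where "u t = \<theta> + \<sigma> * (t - t1) / R" for t
  define g where "g t = (- 1 / R) *\<^sub>R direction (u t)" for t
  have u: "(u has_real_derivative \<sigma> / R) (at t within A)" for t A
    unfolding u_def using R by (auto intro!: derivative_eq_intros)
  have [continuous_intros]: "continuous_on A u" for A
    unfolding u_def by (intro continuous_intros) (use R in auto)
  have d1: "((\<lambda>t. direction (u t)) has_vector_derivative (\<sigma> / R) *\<^sub>R direction (u t + pi / 2))
      (at t within A)" for t A
    by (rule direction_has_vector_derivative[OF u])
  have d2: "((\<lambda>t. direction (u t + pi / 2)) has_vector_derivative (- \<sigma> / R) *\<^sub>R direction (u t))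
      (at t within A)" for t A
  proof -
    have "((\<lambda>t. u t + pi / 2) has_real_derivative \<sigma> / R) (at t within A)"
      by (auto intro!: derivative_eq_intros u)
    from direction_has_vector_derivative[OF this] show ?thesis
      using direction_add_pi[of "u t"] by (simp add: add.assoc)
  qed
  have \<sigma>2: "\<sigma> * \<sigma> = 1" using \<sigma> by auto
  have circle: "has_weak_deriv2 T (\<lambda>t. c + R *\<^sub>R direction (u t)) g"
  proof (rule weak_deriv2_if_piecewise_deriv)
    show "((\<lambda>t. c + R *\<^sub>R direction (u t)) has_vector_derivative \<sigma> *\<^sub>R direction (u t + pi / 2))
        (at t within {0..T})" for t
      by (rule derivative_eq_intros d1 refl | use R in simp)+
    show "continuous_on {0..T} (\<lambda>t. \<sigma> *\<^sub>R direction (u t + pi / 2))"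
      by (intro continuous_intros)
    show "((\<lambda>t. \<sigma> *\<^sub>R direction (u t + pi / 2)) has_vector_derivative g t) (at t)" for t
      by (rule derivative_eq_intros d2 refl | use \<sigma>2 in \<open>simp add: g_def\<close>)+
    show "L_inf T g"
      unfolding g_def by (intro continuous_imp_L_inf continuous_intros)
  qed (use t in auto)
  \<comment> \<open>The support has to stay strictly inside \<open>(0, T)\<close>, also when \<open>t1 = 0\<close> or \<open>t2 = T\<close>.\<close>
  define \<alpha> \<beta> where "\<alpha> = t1 + (t2 - t1) / 3" and "\<beta> = t1 + 2 * (t2 - t1) / 3"
  have \<alpha>\<beta>: "t1 < \<alpha>" "\<alpha> < \<beta>" "\<beta> < t2"
    using t by (auto simp: \<alpha>_def \<beta>_def field_simps)
  obtain \<psi> \<psi>' \<psi>'' where \<psi>: "C2_test_fun \<alpha> \<beta> \<psi> \<psi>' \<psi>''" "\<And>t. 0 \<le> \<psi> t"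
    "\<And>t. t \<in> {\<alpha><..<\<beta>} \<Longrightarrow> 0 < \<psi> t"
    using C2_bump[OF \<alpha>\<beta>(2)] by blast
  have \<psi>d: "\<And>t. (\<psi> has_real_derivative \<psi>' t) (at t)" "\<And>t. (\<psi>' has_real_derivative \<psi>'' t) (at t)"
    "continuous_on UNIV \<psi>''" "\<And>t. t \<notin> {\<alpha>..\<beta>} \<Longrightarrow> \<psi> t = 0"
    using \<psi>(1) unfolding C2_test_fun_def by auto
  have [continuous_intros]: "continuous_on A \<psi>" "continuous_on A \<psi>'" "continuous_on A \<psi>''" for A
    using \<psi>d by (meson DERIV_isCont continuous_at_imp_continuous_on continuous_on_subset subset_UNIV)+
  have L: "L_inf T a" "L_inf T g"
    using a circle unfolding has_weak_deriv2_def by auto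
  have component: "(LINT t|?L. (\<psi> t * direction (u t) $ i) *\<^sub>R a t) =
      (LINT t|?L. (\<psi> t * direction (u t) $ i) *\<^sub>R g t)" for i
  proof (rule weak_deriv2_eq_if_locally_eq[OF a circle])
    have n1: "((\<lambda>t. direction (u t) $ i) has_real_derivative (\<sigma> / R) * direction (u t + pi / 2) $ i) (at t)" for t
      using bounded_linear.has_vector_derivative[OF bounded_linear_vec_nth d1]
      by (simp add: has_real_derivative_iff_has_vector_derivative)
    have n2: "((\<lambda>t. direction (u t + pi / 2) $ i) has_real_derivative (- \<sigma> / R) * direction (u t) $ i) (at t)" for t
      using bounded_linear.has_vector_derivative[OF bounded_linear_vec_nth d2]
      by (simp add: has_real_derivative_iff_has_vector_derivative)
    let ?\<phi>' = "\<lambda>t. \<psi>' t * direction (u t) $ i + (\<sigma> / R) * direction (u t + pi / 2) $ i * \<psi> t"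
    let ?\<phi>'' = "\<lambda>t. \<psi>'' t * direction (u t) $ i + (\<sigma> / R) * direction (u t + pi / 2) $ i * \<psi>' t +
        ((\<sigma> / R) * ((- \<sigma> / R) * direction (u t) $ i) * \<psi> t + \<psi>' t * ((\<sigma> / R) * direction (u t + pi / 2) $ i))"
    have "((\<lambda>t. \<psi> t * direction (u t) $ i) has_real_derivative ?\<phi>' t) (at t)" for t
      by (rule DERIV_mult[OF \<psi>d(1) n1])
    moreover have "(?\<phi>' has_real_derivative ?\<phi>'' t) (at t)" for t
      by (intro DERIV_add DERIV_mult DERIV_cmult \<psi>d n1 n2)
    moreover have "continuous_on UNIV ?\<phi>''"
      by (intro continuous_intros)
    ultimately show "C2_test_fun \<alpha> \<beta> (\<lambda>t. \<psi> t * direction (u t) $ i) ?\<phi>' ?\<phi>''"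
      unfolding C2_test_fun_def using \<psi>d(4) by simp
    show "z t = c + R *\<^sub>R direction (u t)" if "t \<in> {\<alpha>..\<beta>}" for t
      using arc[of t] that \<alpha>\<beta> by (simp add: u_def)
  qed (use t \<alpha>\<beta> in auto)
  have int: "integrable ?L (\<lambda>t. (\<psi> t * direction (u t) $ i) *\<^sub>R b t)" if "L_inf T b" for b i
    by (intro integrable_continuous_scaleR_L_inf that continuous_intros)
  have radial: "integrable ?L (\<lambda>t. \<psi> t * (direction (u t) \<bullet> b t))"
    "(LINT t|?L. \<psi> t * (direction (u t) \<bullet> b t)) =
      (\<Sum>i\<in>UNIV. (LINT t|?L. (\<psi> t * direction (u t) $ i) *\<^sub>R b t) $ i)" if b: "L_inf T b" for b
  proof -
    have expand: "\<psi> t * (direction (u t) \<bullet> b t) = (\<Sum>i\<in>UNIV. ((\<psi> t * direction (u t) $ i) *\<^sub>R b t) $ i)" for t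
      by (simp add: inner_vec_def sum_distrib_left mult.assoc)
    have int_i: "integrable ?L (\<lambda>t. ((\<psi> t * direction (u t) $ i) *\<^sub>R b t) $ i)" for i
      by (rule integrable_bounded_linear[OF bounded_linear_vec_nth int[OF b]])
    show "integrable ?L (\<lambda>t. \<psi> t * (direction (u t) \<bullet> b t))"
      unfolding expand by (intro Bochner_Integration.integrable_sum int_i)
    show "(LINT t|?L. \<psi> t * (direction (u t) \<bullet> b t)) =
      (\<Sum>i\<in>UNIV. (LINT t|?L. (\<psi> t * direction (u t) $ i) *\<^sub>R b t) $ i)"
      unfolding expand
      by (subst Bochner_Integration.integral_sum[OF int_i])
        (intro sum.cong refl integral_bounded_linear[OF bounded_linear_vec_nth int[OF b]])
  qed
  have "L_inf T (\<lambda>_. direction 0)"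
    by (intro continuous_imp_L_inf continuous_intros)
  then have "integrable ?L (\<lambda>t. (\<psi> t *\<^sub>R direction 0) $ 1)"
    by (intro integrable_bounded_linear[OF bounded_linear_vec_nth] integrable_continuous_scaleR_L_inf continuous_intros)
  then have int_\<psi>: "integrable ?L \<psi>"
    by (simp add: direction_nth)
  have "(LINT t|?L. \<psi> t * (direction (u t) \<bullet> a t)) = (LINT t|?L. \<psi> t * (direction (u t) \<bullet> g t))"
    unfolding radial(2)[OF L(1)] radial(2)[OF L(2)] component ..
  also have "\<dots> = (LINT t|?L. - (\<psi> t / R))"
    by (simp add: g_def dot_square_norm)
  also have "\<dots> = - ((LINT t|?L. \<psi> t) / R)"
    by simp
  finally have pairing: "(LINT t|?L. - (\<psi> t * (direction (u t) \<bullet> a t))) = (LINT t|?L. \<psi> t) / R"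
    by simp
  have "(LINT t|?L. - (\<psi> t * (direction (u t) \<bullet> a t))) \<le> (LINT t|?L. m * \<psi> t)"
  proof (rule integral_mono_AE)
    show "AE t in ?L. - (\<psi> t * (direction (u t) \<bullet> a t)) \<le> m * \<psi> t"
      using esssup_AE[of "\<lambda>t. ereal (norm (a t))" ?L]
    proof eventually_elim
      case (elim t)
      then have "ereal (norm (a t)) < ereal m" using m(1) by (rule le_less_trans)
      moreover have "- (direction (u t) \<bullet> a t) \<le> norm (a t)"
        using Cauchy_Schwarz_ineq2[of "direction (u t)" "a t"] by simp
      ultimately have "- (direction (u t) \<bullet> a t) \<le> m" by simp
      from mult_left_mono[OF this \<psi>(2)[of t]] show ?case by (simp add: mult.commute)
    qed
  qed (use radial(1)[OF L(1)] int_\<psi> in auto)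
  then have "(LINT t|?L. \<psi> t) / R \<le> m * (LINT t|?L. \<psi> t)"
    unfolding pairing by simp
  moreover have "(LINT t|?L. \<psi> t) > 0"
  proof -
    have "(LINT t|?L. \<psi> t) = integral {0..T} \<psi>"
      using int_\<psi> by (subst lebesgue_integral_eq_integral) (auto simp: integral_open_interval_real)
    moreover have "integral {0..T} \<psi> \<noteq> 0"
    proof
      assume "integral {0..T} \<psi> = 0"
      moreover have "continuous_on {0..T} \<psi>" by (intro continuous_intros)
      ultimately have "(\<psi> has_integral 0) (cbox 0 T)"
        using integrable_continuous_interval by (metis cbox_interval integrable_integral)
      then have "\<psi> ((\<alpha> + \<beta>) / 2) = 0"
        by (intro has_integral_0_cbox_imp_0[of 0 T \<psi>] continuous_intros) (use \<psi>(2) t \<alpha>\<beta> in auto)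
      then show False using \<psi>(3)[of "(\<alpha> + \<beta>) / 2"] \<alpha>\<beta> by simp
    qed
    moreover have "(LINT t|?L. \<psi> t) \<ge> 0"
      using \<psi>(2) by simp
    ultimately show ?thesis by simp
  qed
  ultimately have "1 / R \<le> m"
    by (simp add: divide_inverse mult.commute)
  with m(2) show False by simp
qed

section \<open>Geometry of the SOS path\<close>

text \<open>
  A one-sided computation inside \<open>[l, r]\<close> determines the velocity even at the endpoints \<open>l\<close> and
  \<open>r\<close>, because the velocity of a \<open>C1\<close> curve exists there. This is how tangency is transferred from
  the circle to the two segments.
\<close>

lemma velocity_eq:
  assumes "C1_curve T z" "0 \<le> l" "l < r" "r \<le> T" "t \<in> {l..r}"
    and eq: "\<And>s. s \<in> {l..r} \<Longrightarrow> z s = h s"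
    and h: "(h has_vector_derivative w) (at t within {l..r})"
  shows "velocity T z t = w"
proof -
  have "(z has_vector_derivative velocity T z t) (at t within {l..r})"
    by (rule has_vector_derivative_within_subset[of _ _ _ "{0..T}"])
      (use assms in \<open>auto simp: C1_curve_def\<close>)
  moreover have "(z has_vector_derivative w) (at t within {l..r})"
    by (rule has_vector_derivative_transform[OF _ _ h]) (use assms in auto)
  ultimately show ?thesis
    using assms vector_derivative_unique_within_closed_interval[of l r t z "velocity T z t" w]
    by simp
qed

text \<open>
  The velocity at the beginning of the circle equals the one at its end, since the circle is covered
  exactly once. Both segments inherit this direction by tangency, and in place of a segment of
  length zero the circle itself supplies the boundary velocity. As the circle also closes up in
  position, the total displacement is that of the two segments.
\<close>

lemma SOS_path_geometry:
  assumes "SOS_path T z"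
  obtains R t1 c \<theta> \<sigma> x where "R > 0" "0 \<le> t1" "t1 + 2 * pi * R \<le> T" "\<sigma> \<in> {1, -1}"
    "\<And>t. t \<in> {t1..t1 + 2 * pi * R} \<Longrightarrow> z t = c + R *\<^sub>R direction (\<theta> + \<sigma> * (t - t1) / R)"
    "velocity T z 0 = direction x" "velocity T z T = direction x"
    "z T = z 0 + (T - 2 * pi * R) *\<^sub>R direction x"
proof -
  have C1: "C1_curve T z" and unit: "\<forall>t\<in>{0..T}. norm (velocity T z t) = 1"
    using assms by (auto simp: SOS_path_def)
  obtain R t1 t2 c \<theta> \<sigma> u w where R: "R > 0" and t1: "0 \<le> t1" and t2: "t2 = t1 + 2 * pi * R"
    and T: "t2 \<le> T" and \<sigma>: "\<sigma> \<in> {1, -1}" and seg1: "\<forall>t\<in>{0..t1}. z t = z 0 + t *\<^sub>R u"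
    and arc: "\<forall>t\<in>{t1..t2}. z t = c + R *\<^sub>R direction (\<theta> + \<sigma> * (t - t1) / R)"
    and seg2: "\<forall>t\<in>{t2..T}. z t = z t2 + (t - t2) *\<^sub>R w"
    using assms unfolding SOS_path_def vector_cos_sin_eq_direction by blast
  have t12: "t1 < t2" using R t2 by simp
  define e where "e t = \<theta> + \<sigma> * (t - t1) / R" for t
  have e: "(e has_real_derivative \<sigma> / R) (at t within A)" for t A
    unfolding e_def using R by (auto intro!: derivative_eq_intros)
  have vel_arc: "velocity T z t = \<sigma> *\<^sub>R direction (e t + pi / 2)" if "t \<in> {t1..t2}" for t
  proof (rule velocity_eq[OF C1 t1 t12 T that])
    show "z s = c + R *\<^sub>R direction (e s)" if "s \<in> {t1..t2}" for s
      using arc that by (simp add: e_def)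
    show "((\<lambda>s. c + R *\<^sub>R direction (e s)) has_vector_derivative \<sigma> *\<^sub>R direction (e t + pi / 2))
        (at t within {t1..t2})"
      by (rule derivative_eq_intros direction_has_vector_derivative[OF e] refl | use R in simp)+
  qed
  define p where "p = velocity T z t1"
  have "norm p = 1"
    using unit t1 t12 T by (simp add: p_def)
  then obtain x where x: "p = direction x"
    by (rule unit_vector_eq_direction)
  have full_turn: "e t2 = e t1 + \<sigma> * (2 * pi)"
    using R by (simp add: e_def t2)
  then have period: "direction (e t2 + y) = direction (e t1 + y)" for y
    using \<sigma> by (auto simp: direction_def sin_add cos_add sin_diff cos_diff)
  have p2: "velocity T z t2 = p"
    using vel_arc[of t1] vel_arc[of t2] period t12 by (simp add: p_def)
  have closed: "z t2 = z t1"
    using arc period[of 0] t12 by (simp add: e_def)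
  have start: "velocity T z 0 = p \<and> z t1 = z 0 + t1 *\<^sub>R p"
  proof (cases "t1 = 0")
    case False
    then have pos: "0 < t1" "t1 \<le> T" using t1 t12 T by auto
    have "velocity T z t = u" if "t \<in> {0..t1}" for t
    proof (rule velocity_eq[OF C1 order_refl pos that])
      show "z s = z 0 + s *\<^sub>R u" if "s \<in> {0..t1}" for s
        by (rule bspec[OF seg1 that])
      show "((\<lambda>s. z 0 + s *\<^sub>R u) has_vector_derivative u) (at t within {0..t1})"
        by (rule derivative_eq_intros refl | simp)+
    qed
    from this[of 0] this[of t1] have "velocity T z 0 = u" "p = u"
      using t1 by (simp_all add: p_def)
    moreover have "z t1 = z 0 + t1 *\<^sub>R u"
      by (rule bspec[OF seg1]) (use t1 in simp)
    ultimately show ?thesis by simp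
  qed (simp add: p_def)
  have finish: "velocity T z T = p \<and> z T = z t2 + (T - t2) *\<^sub>R p"
  proof (cases "t2 = T")
    case False
    then have pos: "0 \<le> t2" "t2 < T" using t1 t12 T by auto
    have "velocity T z t = w" if "t \<in> {t2..T}" for t
    proof (rule velocity_eq[OF C1 pos order_refl that])
      show "z s = z t2 + (s - t2) *\<^sub>R w" if "s \<in> {t2..T}" for s
        by (rule bspec[OF seg2 that])
      show "((\<lambda>s. z t2 + (s - t2) *\<^sub>R w) has_vector_derivative w) (at t within {t2..T})"
        by (rule derivative_eq_intros refl | simp)+
    qed
    from this[of T] this[of t2] have "velocity T z T = w" "p = w"
      using p2 pos by simp_all
    moreover have "z T = z t2 + (T - t2) *\<^sub>R w"
      by (rule bspec[OF seg2]) (use pos in simp)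
    ultimately show ?thesis by simp
  qed (use p2 in simp)
  have "z T = z 0 + (T - 2 * pi * R) *\<^sub>R p"
    using start finish closed by (simp add: t2 algebra_simps)
  then show ?thesis
    using start finish T arc unfolding x t2 by (intro that[OF R t1 _ \<sigma>]) blast+
qed

section \<open>Unit-speed curves with prescribed heading\<close>

definition heading_curve :: "real ^ 2 \<Rightarrow> (real \<Rightarrow> real) \<Rightarrow> curve" where
  "heading_curve x0 \<theta> t = x0 + integral {0..t} (\<lambda>s. direction (\<theta> s))"

text \<open>
  The velocity is the direction of the heading, so the speed is \<open>1\<close> and the norm of the acceleration
  is the rate of turning \<open>\<bar>\<omega>\<bar>\<close>.
\<close>

lemma heading_curve_admissible:
  assumes T: "0 < T" and S: "finite S" and \<theta>: "continuous_on {0..T} \<theta>"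
    and deriv: "\<And>t. t \<in> {0<..<T} - S \<Longrightarrow> (\<theta> has_real_derivative \<omega> t) (at t)"
    and \<omega>: "\<omega> \<in> borel_measurable borel" "\<And>t. t \<in> {0<..<T} \<Longrightarrow> \<bar>\<omega> t\<bar> \<le> \<kappa>"
  shows "admissible T x0 (heading_curve x0 \<theta> T) (direction (\<theta> 0)) (direction (\<theta> T)) (heading_curve x0 \<theta>)"
    and "max_accel T (heading_curve x0 \<theta>) \<le> ereal \<kappa>"
proof -
  let ?y = "heading_curve x0 \<theta>" and ?v = "\<lambda>t. direction (\<theta> t)"
  let ?a = "\<lambda>t. \<omega> t *\<^sub>R direction (\<theta> t + pi / 2)"
  have v: "continuous_on {0..T} ?v"
    by (intro continuous_intros \<theta>)
  have y: "(?y has_vector_derivative ?v t) (at t within {0..T})" if "t \<in> {0..T}" for t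
  proof -
    have "((\<lambda>t. integral {0..t} ?v) has_vector_derivative ?v t) (at t within {0..T})"
      by (rule integral_has_vector_derivative[OF v that])
    from has_vector_derivative_add[OF has_vector_derivative_const this] show ?thesis
      by (simp add: heading_curve_def[abs_def])
  qed
  have vel: "velocity T ?y t = ?v t" if "t \<in> {0..T}" for t
    unfolding velocity_def using vector_derivative_within_cbox[of 0 T t ?y "?v t"] T that y by simp
  have "\<omega> \<in> borel_measurable (lebesgue_on {0<..<T})"
    using \<omega>(1) by (intro measurable_restrict_space1 measurable_completion) simp
  moreover have "(\<lambda>t. direction (\<theta> t + pi / 2)) \<in> borel_measurable (lebesgue_on {0<..<T})"
    by (intro continuous_imp_measurable_on_sets_lebesgue continuous_intros continuous_on_subset[OF \<theta>]) auto
  ultimately have meas: "?a \<in> borel_measurable (lebesgue_on {0<..<T})"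
    by (rule borel_measurable_scaleR)
  have bound: "norm (?a t) \<le> \<kappa>" if "t \<in> {0<..<T}" for t
    using \<omega>(2)[OF that] by simp
  note a = L_infI[of ?a T \<kappa>, OF meas bound]
  have weak: "has_weak_deriv2 T ?y ?a"
  proof (rule weak_deriv2_if_piecewise_deriv[OF S _ y v _ a(1)])
    show "((\<lambda>t. direction (\<theta> t)) has_vector_derivative ?a t) (at t)" if "t \<in> {0<..<T} - S" for t
      by (rule direction_has_vector_derivative[OF deriv[OF that]])
  qed (use T in auto)
  show "max_accel T ?y \<le> ereal \<kappa>"
    unfolding max_accel_def by (rule INF_lower2[of ?a]) (use weak a(2) in auto)
  have "continuous_on {0..T} (velocity T ?y)"
    by (rule continuous_on_eq[OF v]) (simp add: vel)
  then have "C1_curve T ?y"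
    unfolding C1_curve_def using y vel by simp
  moreover have "AE t in lebesgue_on {0<..<T}. norm (velocity T ?y t) = 1"
    by (rule AE_I2) (use vel in auto)
  moreover have "?y 0 = x0"
    by (simp add: heading_curve_def)
  ultimately show "admissible T x0 (?y T) (direction (\<theta> 0)) (direction (\<theta> T)) ?y"
    unfolding admissible_def W2_inf_def using weak vel T by auto
qed

lemma direction_linear_has_integral:
  assumes "k \<noteq> 0" "l \<le> r"
  shows "((\<lambda>t. direction (c + k * t)) has_integral
    (1 / k) *\<^sub>R (direction (c + k * r - pi / 2) - direction (c + k * l - pi / 2))) {l..r}"
proof -
  have "((\<lambda>t. (1 / k) *\<^sub>R direction (c + k * t - pi / 2)) has_vector_derivative direction (c + k * t))
      (at t within {l..r})" for t
  proof -
    have "((\<lambda>t. c + k * t - pi / 2) has_real_derivative k) (at t within {l..r})"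
      by (auto intro!: derivative_eq_intros)
    from direction_has_vector_derivative[OF this]
    have "((\<lambda>t. direction (c + k * t - pi / 2)) has_vector_derivative k *\<^sub>R direction (c + k * t))
        (at t within {l..r})" by simp
    from bounded_linear.has_vector_derivative[OF bounded_linear_scaleR_right this, of "1 / k"]
    show ?thesis using assms(1) by simp
  qed
  from fundamental_theorem_of_calculus[OF assms(2) this] show ?thesis
    by (simp add: scaleR_diff_right)
qed

text \<open>
  The triangle wave with slopes \<open>1\<close>, \<open>-1\<close>, \<open>1\<close> on \<open>[0, T]\<close> through
  \<open>0\<close>, \<open>T / 4\<close>, \<open>- T / 4\<close>, \<open>0\<close>; written with \<open>max\<close> and \<open>min\<close> its continuity is immediate.
\<close>

definition zigzag :: "real \<Rightarrow> real \<Rightarrow> real" where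
  "zigzag T t = max (min t (T / 2 - t)) (t - T)"

lemma zigzag_cases:
  "t \<le> T / 4 \<Longrightarrow> 0 \<le> T \<Longrightarrow> zigzag T t = t"
  "T / 4 \<le> t \<Longrightarrow> t \<le> 3 * T / 4 \<Longrightarrow> zigzag T t = T / 2 - t"
  "3 * T / 4 \<le> t \<Longrightarrow> 0 \<le> T \<Longrightarrow> zigzag T t = t - T"
  by (auto simp: zigzag_def max_def min_def)

text \<open>
  The factor \<open>4 * A / T\<close> scales the amplitude \<open>T / 4\<close> of the zigzag to \<open>A\<close>. On each linear
  piece the antiderivative of the direction is the direction turned back by a right angle, here \<open>D\<close>,
  divided by the slope; adding the pieces leaves \<open>2 / k\<close> times \<open>D (x + A) - D (x - A)\<close>.
\<close>

lemma integral_zigzag_direction: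
  assumes T: "0 < T" and A: "0 < A"
  shows "((\<lambda>t. direction (x + 4 * A / T * zigzag T t)) has_integral (T * sinc A) *\<^sub>R direction x) {0..T}"
proof -
  define k where "k = 4 * A / T"
  define D where "D y = direction (y - pi / 2)" for y
  have k: "k \<noteq> 0" "- k \<noteq> 0" and kT: "k * T = 4 * A"
    using T A by (auto simp: k_def)
  let ?f = "\<lambda>t. direction (x + k * zigzag T t)"
  have 1: "(?f has_integral (1 / k) *\<^sub>R (D (x + A) - D x)) {0..T / 4}"
  proof (rule has_integral_eq)
    show "((\<lambda>t. direction (x + k * t)) has_integral (1 / k) *\<^sub>R (D (x + A) - D x)) {0..T / 4}"
      using direction_linear_has_integral[OF k(1), of 0 "T / 4" x] T kT by (simp add: D_def)
  qed (use T in \<open>simp add: zigzag_cases\<close>)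
  have 2: "(?f has_integral (1 / k) *\<^sub>R (D (x + A) - D (x - A))) {T / 4..3 * T / 4}"
  proof (rule has_integral_eq)
    have ends: "x + 2 * A + - k * (3 * T / 4) = x - A" "x + 2 * A + - k * (T / 4) = x + A"
      using kT by (auto simp: field_simps)
    have "((\<lambda>t. direction (x + 2 * A + - k * t)) has_integral
        (1 / - k) *\<^sub>R (D (x - A) - D (x + A))) {T / 4..3 * T / 4}"
      using direction_linear_has_integral[OF k(2), of "T / 4" "3 * T / 4" "x + 2 * A"] T
      unfolding ends D_def by simp
    then show "((\<lambda>t. direction (x + 2 * A + - k * t)) has_integral
        (1 / k) *\<^sub>R (D (x + A) - D (x - A))) {T / 4..3 * T / 4}"
      by (simp add: scaleR_diff_right)
    show "direction (x + 2 * A + - k * t) = ?f t" if "t \<in> {T / 4..3 * T / 4}" for t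
    proof -
      have "x + 2 * A + - k * t = x + k * (T / 2 - t)"
        using kT by (simp add: algebra_simps)
      also have "T / 2 - t = zigzag T t"
        using that by (simp add: zigzag_cases)
      finally show ?thesis by (rule arg_cong)
    qed
  qed
  have 3: "(?f has_integral (1 / k) *\<^sub>R (D x - D (x - A))) {3 * T / 4..T}"
  proof (rule has_integral_eq)
    have ends: "x - 4 * A + k * T = x" "x - 4 * A + k * (3 * T / 4) = x - A"
      using kT by (auto simp: field_simps)
    show "((\<lambda>t. direction (x - 4 * A + k * t)) has_integral (1 / k) *\<^sub>R (D x - D (x - A))) {3 * T / 4..T}"
      using direction_linear_has_integral[OF k(1), of "3 * T / 4" T "x - 4 * A"] T
      unfolding ends D_def by simp
    show "direction (x - 4 * A + k * t) = ?f t" if "t \<in> {3 * T / 4..T}" for t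
    proof -
      have "x - 4 * A + k * t = x + k * (t - T)"
        using kT by (simp add: algebra_simps)
      also have "t - T = zigzag T t"
        using that T by (simp add: zigzag_cases)
      finally show ?thesis by (rule arg_cong)
    qed
  qed
  have "(?f has_integral (1 / k) *\<^sub>R (D (x + A) - D x) + (1 / k) *\<^sub>R (D (x + A) - D (x - A)) +
      (1 / k) *\<^sub>R (D x - D (x - A))) {0..T}"
    by (rule has_integral_combine[OF _ _ has_integral_combine[OF _ _ 1 2] 3]) (use T in auto)
  also have "(1 / k) *\<^sub>R (D (x + A) - D x) + (1 / k) *\<^sub>R (D (x + A) - D (x - A)) +
      (1 / k) *\<^sub>R (D x - D (x - A)) = (2 / k) *\<^sub>R (D (x + A) - D (x - A))"
    by (simp add: vec_eq_iff field_simps)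
  also have "D (x + A) - D (x - A) = (2 * sin A) *\<^sub>R direction x"
    by (simp add: D_def vec_eq_iff forall_2 direction_nth sin_diff cos_diff sin_add cos_add)
  also have "(2 / k) *\<^sub>R (2 * sin A) *\<^sub>R direction x = (T * sinc A) *\<^sub>R direction x"
    using A T by (simp add: k_def)
  finally show ?thesis by (simp add: k_def)
qed

text \<open>
  The initial and final headings agree with the direction of the displacement, as for an SOS path,
  and the rate of turning is constantly \<open>4 * A / T\<close> in absolute value.
\<close>

lemma zigzag_competitor:
  assumes T: "0 < T" and A: "0 < A"
  obtains y where "admissible T x0 (x0 + (T * sinc A) *\<^sub>R direction x) (direction x) (direction x) y"
    "max_accel T y \<le> ereal (4 * A / T)"
proof -
  define k where "k = 4 * A / T"
  define \<theta> where "\<theta> t = x + k * zigzag T t" for t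
  define \<omega> where "\<omega> t = (if T / 4 \<le> t \<and> t \<le> 3 * T / 4 then - k else k)" for t
  have k: "k > 0" using T A by (simp add: k_def)
  have \<theta>: "continuous_on {0..T} \<theta>"
    unfolding \<theta>_def zigzag_def by (intro continuous_intros)
  have "\<omega> = (\<lambda>t. if t \<in> {T / 4..3 * T / 4} then - k else k)"
    by (auto simp: \<omega>_def)
  then have \<omega>: "\<omega> \<in> borel_measurable borel"
    by simp
  have deriv: "(\<theta> has_real_derivative \<omega> t) (at t)" if "t \<in> {0<..<T} - {T / 4, 3 * T / 4}" for t
  proof -
    have "t \<noteq> T / 4" "t \<noteq> 3 * T / 4" using that by simp_all
    then consider "t < T / 4" | "T / 4 < t" "t < 3 * T / 4" | "3 * T / 4 < t"
      by linarith
    then show ?thesis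
    proof cases
      case 1
      have "((\<lambda>t. x + k * t) has_real_derivative \<omega> t) (at t)"
        using 1 by (auto intro!: derivative_eq_intros simp: \<omega>_def)
      then show ?thesis
        by (rule has_field_derivative_transform_within_open[of _ _ _ "{..<T / 4}"])
          (use 1 T in \<open>auto simp: \<theta>_def zigzag_cases\<close>)
    next
      case 2
      have "((\<lambda>t. x + k * (T / 2 - t)) has_real_derivative \<omega> t) (at t)"
        using 2 by (auto intro!: derivative_eq_intros simp: \<omega>_def)
      then show ?thesis
        by (rule has_field_derivative_transform_within_open[of _ _ _ "{T / 4<..<3 * T / 4}"])
          (use 2 T in \<open>auto simp: \<theta>_def zigzag_cases\<close>)
    next
      case 3
      have "((\<lambda>t. x + k * (t - T)) has_real_derivative \<omega> t) (at t)"
        using 3 by (auto intro!: derivative_eq_intros simp: \<omega>_def)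
      then show ?thesis
        by (rule has_field_derivative_transform_within_open[of _ _ _ "{3 * T / 4<..}"])
          (use 3 T in \<open>auto simp: \<theta>_def zigzag_cases\<close>)
    qed
  qed
  have bound: "\<bar>\<omega> t\<bar> \<le> k" for t
    using k by (simp add: \<omega>_def)
  have fin: "finite {T / 4, 3 * T / 4}" by simp
  have "\<theta> 0 = x" "\<theta> T = x"
    using T by (simp_all add: \<theta>_def zigzag_cases)
  moreover have "heading_curve x0 \<theta> T = x0 + (T * sinc A) *\<^sub>R direction x"
    using integral_zigzag_direction[OF T A, of x] unfolding heading_curve_def \<theta>_def k_def
    by (simp add: integral_unique)
  ultimately show ?thesis
    using that[of "heading_curve x0 \<theta>"] heading_curve_admissible[OF T fin \<theta> deriv \<omega> bound, of x0]
    by (simp add: k_def)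
qed

section \<open>Comparison\<close>

theorem proposition22:
  fixes T b d :: real and z :: "real \<Rightarrow> real ^ 2"
  assumes "SOS_path T z"
    and "d = norm (z 0 - z T)"
    and "0 \<le> b" and "b < 1" and "sinc_inv b * (1 - b) = pi / 2"
    and "d / T > b"
  shows "\<not> solution_P T (z 0) (z T) (velocity T z 0) (velocity T z T) z"
proof
  assume sol: "solution_P T (z 0) (z T) (velocity T z 0) (velocity T z T) z"
  obtain R t1 c \<theta> \<sigma> x where R: "R > 0" and t1: "0 \<le> t1" "t1 + 2 * pi * R \<le> T" and \<sigma>: "\<sigma> \<in> {1, -1}"
    and arc: "\<And>t. t \<in> {t1..t1 + 2 * pi * R} \<Longrightarrow> z t = c + R *\<^sub>R direction (\<theta> + \<sigma> * (t - t1) / R)"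
    and vel: "velocity T z 0 = direction x" "velocity T z T = direction x"
    and zT: "z T = z 0 + (T - 2 * pi * R) *\<^sub>R direction x"
    by (rule SOS_path_geometry[OF assms(1)], rule that)
  have piR: "0 < 2 * pi * R" using R by simp
  then have T: "0 < T" using t1 by linarith
  have d: "d = T - 2 * pi * R"
    using assms(2) t1 by (simp add: zT)
  define r where "r = d / T"
  have r: "b < r" "r < 1" "0 \<le> r" and rT: "T * r = T - 2 * pi * R"
    using assms(3,6) T piR by (auto simp: r_def d)
  define A where "A = sinc_inv r"
  have sincA: "sinc A = r" and "A \<in> {0..pi}"
    unfolding A_def by (rule sinc_inv_properties; use r in linarith)+
  moreover have "A \<noteq> 0" using sincA r(2) by auto
  ultimately have A: "0 < A" by auto
  \<comment> \<open>Both factors of \<open>sinc_inv r * (1 - r)\<close> are smaller than at \<open>b\<close>.\<close>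
  have "A < sinc_inv b"
    unfolding A_def by (rule sinc_inv_strict_decreasing) (use r assms(3) in auto)
  then have "A * (1 - r) < sinc_inv b * (1 - r)"
    using r by simp
  also have "\<dots> \<le> sinc_inv b * (1 - b)"
    using \<open>A < sinc_inv b\<close> A r by (intro mult_left_mono) auto
  finally have "A * (1 - r) < pi / 2"
    using assms(5) by simp
  then have "A * (T - T * r) < T * (pi / 2)"
    using T mult_strict_left_mono[of "A * (1 - r)" "pi / 2" T] by (simp add: algebra_simps)
  then have "4 * A * R < T"
    unfolding rT by simp
  then have less: "4 * A / T < 1 / R"
    using T R by (simp add: field_simps)
  obtain y where y: "admissible T (z 0) (z 0 + (T * sinc A) *\<^sub>R direction x) (direction x) (direction x) y"
    "max_accel T y \<le> ereal (4 * A / T)"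
    using zigzag_competitor[OF T A] .
  have "admissible T (z 0) (z T) (velocity T z 0) (velocity T z T) y"
    using y(1) unfolding sincA rT vel zT .
  then have "max_accel T z \<le> max_accel T y"
    using sol by (auto simp: solution_P_def)
  also note y(2)
  also have "ereal (4 * A / T) < ereal (1 / R)"
    using less by simp
  also have "ereal (1 / R) \<le> max_accel T z"
    by (rule max_accel_circular_arc[OF t1(1) _ t1(2) R \<sigma> arc]) (use piR in auto)
  finally show False by simp
qed

end
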